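(* Let $T$ be a finite tree, let $U$ be a finite set of resources with supports $(Q_x)_{x\in U}$ (subtrees of $T$), let $\mathcal A=(A_e)_{e\in E(T)}$ be a tree-structured hypergraph system on $T$ and $U$, and let $q:E(T)\to\mathbb Z_{>0}$ be a multiplicity function. Let $\rho(\mathcal A,q)$ be the maximum of $\sum_{e\in E(T)}|M_e|$ over all partial $q$-SDRs $(M_e)_{e\in E(T)}$ for $\mathcal A$. Then $$\rho(\mathcal A,q)=\min_{F\subseteq E(T)}\bigl(q(E(T)\setminus F)+\nu(A(F))\bigr)=q(E(T))-\max_{F\subseteq E(T)}\bigl(q(F)-\nu(A(F))\bigr).$$
   Context: Let $T$ be a finite tree and $U$ a finite set, whose elements are called resources. Each $x\in U$ is assigned a subtree (nonempty connected subgraph) $Q_x$ of $T$, called its support. For $t\in V(T)$ put $P_t:=\{x\in U: t\in V(Q_x)\}$. A family $\mathcal A=(A_e)_{e\in E(T)}$ is a tree-structured hypergraph system if, for every edge $e=tu$ of $T$, $A_e$ is a hypergraph with vertex set $U$ such that: (i) the loops (singleton hyperedges) of $A_e$ are exactly the sets $\{x\}$ with $x\in P_t\cap P_u$; (ii) every nonloop hyperedge of $A_e$ is a two-element set of the form $\{x,y\}$ with $x\in P_t$ and $y\in P_u$ (not every such pair need be a hyperedge). Write $q_e:=q(e)$. For $F\subseteq E(T)$, $A(F)$ denotes the hypergraph on $U$ with hyperedge set $\bigcup_{e\in F}E(A_e)$, and $q(F):=\sum_{e\in F}q_e$. A matching in a hypergraph is a set of pairwise disjoint hyperedges (loops count as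 singleton hyperedges), and $\nu$ denotes the maximum size of a matching. A partial $q$-SDR for $\mathcal A$ chooses, for each $e\in E(T)$, a set $M_e\subseteq E(A_e)$ with $|M_e|\le q_e$, such that all chosen hyperedges (over all $e$) are pairwise vertex disjoint. *)

theory Defs
  imports "Graph_Theory.Digraph_Component" "HOL-Library.Disjoint_Sets"
begin

text \<open>
  A finite simple graph is a \<^locale>\<open>pair_graph\<close>: a finite loop-free digraph with a symmetric set
  of arcs. An undirected edge is thus a pair of opposite arcs, and it is identified here with the
  two-element set of its ends.
\<close>

definition uedges :: "'v pair_pre_digraph \<Rightarrow> 'v set set" where
  "uedges T = {{t, u} | t u. (t, u) \<in> parcs T}"

text \<open>
  The predicates \<^const>\<open>forest\<close> and \<^const>\<open>tree\<close> of the library are not usable for symmetric digraphs,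
  because \<^const>\<open>pre_digraph.cycle\<close> accepts the walk going back and forth along one edge. The cycles
  of the undirected graph are the ones of length at least three.
\<close>

definition finite_tree :: "'v pair_pre_digraph \<Rightarrow> bool" where
  "finite_tree T \<longleftrightarrow> pair_graph T \<and> connected (with_proj T) \<and>
     (\<nexists>p. pre_digraph.cycle (with_proj T) p \<and> 3 \<le> length p)"

text \<open>Nonemptiness is part of \<^const>\<open>connected\<close>.\<close>

definition subtree :: "'v pair_pre_digraph \<Rightarrow> 'v pair_pre_digraph \<Rightarrow> bool" where
  "subtree S T \<longleftrightarrow> pair_graph S \<and> subgraph (with_proj S) (with_proj T) \<and> connected (with_proj S)"

definition resources_at :: "'x set \<Rightarrow> ('x \<Rightarrow> 'v pair_pre_digraph) \<Rightarrow> 'v \<Rightarrow> 'x set" where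
  "resources_at U Q t = {x \<in> U. t \<in> pverts (Q x)}"

text \<open>
  A hypergraph on \<open>U\<close> is given by its set of hyperedges. The quantification runs over both
  orientations of an edge; the conditions are symmetric in \<open>t\<close> and \<open>u\<close>.
\<close>

definition tree_structured_hypergraph_system ::
  "'v pair_pre_digraph \<Rightarrow> 'x set \<Rightarrow> ('x \<Rightarrow> 'v pair_pre_digraph) \<Rightarrow> ('v set \<Rightarrow> 'x set set) \<Rightarrow> bool"
where
  "tree_structured_hypergraph_system T U Q A \<longleftrightarrow>
     (\<forall>t u. (t, u) \<in> parcs T \<longrightarrow>
        A {t, u} \<subseteq> Pow U \<and>
        (\<forall>x. {x} \<in> A {t, u} \<longleftrightarrow> x \<in> resources_at U Q t \<inter> resources_at U Q u) \<and>
        (\<forall>h \<in> A {t, u}. \<not> is_singleton h \<longrightarrow>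
           (\<exists>x y. x \<noteq> y \<and> h = {x, y} \<and> x \<in> resources_at U Q t \<and> y \<in> resources_at U Q u)))"

definition hyperedges_of :: "('v set \<Rightarrow> 'x set set) \<Rightarrow> 'v set set \<Rightarrow> 'x set set" where
  "hyperedges_of A F = (\<Union>e\<in>F. A e)"

definition matching :: "'x set set \<Rightarrow> 'x set set \<Rightarrow> bool" where
  "matching H M \<longleftrightarrow> M \<subseteq> H \<and> disjoint M"

definition matching_number :: "'x set set \<Rightarrow> nat" where
  "matching_number H = Max {card M | M. matching H M}"

text \<open>
  Disjointness is required of the family indexed by the pairs \<open>(e, h)\<close> with \<open>h \<in> M e\<close>, so that one
  and the same set of resources cannot be chosen for two different edges of the tree.
\<close>

definition partial_SDR ::
  "'v pair_pre_digraph \<Rightarrow> ('v set \<Rightarrow> 'x set set) \<Rightarrow> ('v set \<Rightarrow> nat) \<Rightarrow> ('v set \<Rightarrow> 'x set set) \<Rightarrow> bool"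
where
  "partial_SDR T A q M \<longleftrightarrow>
     (\<forall>e \<in> uedges T. M e \<subseteq> A e \<and> card (M e) \<le> q e) \<and>
     disjoint_family_on snd (SIGMA e:uedges T. M e)"

definition max_partial_SDR ::
  "'v pair_pre_digraph \<Rightarrow> ('v set \<Rightarrow> 'x set set) \<Rightarrow> ('v set \<Rightarrow> nat) \<Rightarrow> nat"
where
  "max_partial_SDR T A q = Max {\<Sum>e\<in>uedges T. card (M e) | M. partial_SDR T A q M}"

end

theory Submission
  imports Defs
begin

text \<open>
  Write a partial SDR as a packing: a set of pairs of an edge \<open>e\<close> and a hyperedge of \<open>A e\<close>, with
  pairwise disjoint hyperedges and at most \<open>q e\<close> pairs for each \<open>e\<close>. The dual object is a cover
  \<open>(W, Z)\<close>, a set \<open>W\<close> of resources and a set \<open>Z\<close> of edges of the tree such that \<open>W\<close> meets every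
  hyperedge of every \<open>A e\<close> with \<open>e \<notin> Z\<close>; its cost is \<open>card W + sum q Z\<close>. For \<open>F = E(T) - Z\<close> the set
  \<open>W\<close> is a transversal of \<open>A(F)\<close>, so the cost is at least \<open>q(E(T) - F) + \<nu>(A(F))\<close>, which in turn is
  at least the size of every partial SDR. The theorem thus follows once some packing is as large as
  the cheapest cover (\<open>tree_packing\<close>).

  That is proved by induction on the tree, removing a leaf \<open>t\<close> with neighbour \<open>u\<close>. The resources
  \<open>X\<close> whose support contains \<open>u\<close> are the only ones that both the rest of the tree and the edge
  \<open>{t, u}\<close> can use, so \<open>X\<close> has to be divided between the two. If the cheapest cover costs of the two
  parts, as functions of the share of \<open>X\<close> that the part receives, are submodular, then the exchange
  argument of the matroid union theorem (\<open>submodular_partition\<close>) yields a division for which the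
  two costs add up to the cost of a cover of the whole system. Packings of that size exist in the
  rest of the tree by induction and at the single edge by Konig's theorem.

  The submodularity (\<open>cover_cost_submodular\<close>) comes from a rearrangement of two covers
  (\<open>covers_split\<close>), and it is here that the shape of the system matters. Mark the vertices of the
  tree with two sides that change exactly across the edges in neither \<open>Z\<^sub>1\<close> nor \<open>Z\<^sub>2\<close>. The support
  of a resource in exactly one of \<open>W\<^sub>1\<close> and \<open>W\<^sub>2\<close> lies on one side, since a support that contains a
  side-changing edge forces the resource into both covers, through its loop. Hence such resources,
  and likewise the edges in exactly one of \<open>Z\<^sub>1\<close> and \<open>Z\<^sub>2\<close>, can be redistributed according to their
  side, and the results are again covers. They have the same total cost, and all resources at
  \<open>u\<close> that occur in only one cover are moved into the first one.
\<close>

section \<open>Dividing a set between two submodular functions\<close>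

definition submodular_on :: "'a set \<Rightarrow> ('a set \<Rightarrow> nat) \<Rightarrow> bool" where
  "submodular_on X f \<longleftrightarrow> (\<forall>A B. A \<subseteq> X \<longrightarrow> B \<subseteq> X \<longrightarrow> f (A \<union> B) + f (A \<inter> B) \<le> f A + f B)"

lemma submodular_onD:
  "submodular_on X f \<Longrightarrow> A \<subseteq> X \<Longrightarrow> B \<subseteq> X \<Longrightarrow> f (A \<union> B) + f (A \<inter> B) \<le> f A + f B"
  by (simp add: submodular_on_def)

lemma submodular_on_subset: "submodular_on Y f \<Longrightarrow> X \<subseteq> Y \<Longrightarrow> submodular_on X f"
  by (auto simp: submodular_on_def)

lemma submodular_on_insert_arg:
  assumes "submodular_on (insert x X) f"
  shows "submodular_on X (\<lambda>A. f (insert x A))"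
  unfolding submodular_on_def
proof (intro allI impI)
  fix A B assume "A \<subseteq> X" "B \<subseteq> X"
  then show "f (insert x (A \<union> B)) + f (insert x (A \<inter> B)) \<le> f (insert x A) + f (insert x B)"
    using submodular_onD[OF assms, of "insert x A" "insert x B"] by auto
qed

text \<open>
  The inequality that is hard in the matroid union theorem. The induction tries to give a new element
  \<open>x\<close> to \<open>f\<close> and to give it to \<open>g\<close>. The induction hypothesis offers a set \<open>Z\<^sub>1\<close> for the first
  attempt and \<open>Z\<^sub>2\<close> for the second, and uncrossing them into \<open>insert x (Z\<^sub>1 \<union> Z\<^sub>2)\<close> and
  \<open>Z\<^sub>1 \<inter> Z\<^sub>2\<close> loses only one in total, because \<open>x\<close> is newly counted once. So the two attempts
  cannot both fail.
\<close>

lemma submodular_partition: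
  fixes f g :: "'a set \<Rightarrow> nat"
  assumes "finite X" "submodular_on X f" "submodular_on X g"
  obtains A B Z where "A \<union> B = X" "A \<inter> B = {}" "Z \<subseteq> X"
    "f Z + g Z + card (X - Z) \<le> f A + g B"
proof -
  have "\<exists>A B Z. A \<union> B = X \<and> A \<inter> B = {} \<and> Z \<subseteq> X \<and> f Z + g Z + card (X - Z) \<le> f A + g B"
    using assms
  proof (induction X arbitrary: f g rule: finite_induct)
    case empty
    show ?case by (intro exI[of _ "{}"]) simp
  next
    case (insert x X)
    note f = submodular_on_subset[OF insert.prems(1) subset_insertI]
      and g = submodular_on_subset[OF insert.prems(2) subset_insertI]
    obtain A\<^sub>1 B\<^sub>1 Z\<^sub>1 where 1: "A\<^sub>1 \<union> B\<^sub>1 = X" "A\<^sub>1 \<inter> B\<^sub>1 = {}" "Z\<^sub>1 \<subseteq> X"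
      "f (insert x Z\<^sub>1) + g Z\<^sub>1 + card (X - Z\<^sub>1) \<le> f (insert x A\<^sub>1) + g B\<^sub>1"
      using insert.IH[OF submodular_on_insert_arg[OF insert.prems(1)] g] by blast
    obtain A\<^sub>2 B\<^sub>2 Z\<^sub>2 where 2: "A\<^sub>2 \<union> B\<^sub>2 = X" "A\<^sub>2 \<inter> B\<^sub>2 = {}" "Z\<^sub>2 \<subseteq> X"
      "f Z\<^sub>2 + g (insert x Z\<^sub>2) + card (X - Z\<^sub>2) \<le> f A\<^sub>2 + g (insert x B\<^sub>2)"
      using insert.IH[OF f submodular_on_insert_arg[OF insert.prems(2)]] by blast
    let ?Y = "insert x X" and ?J = "insert x (Z\<^sub>1 \<union> Z\<^sub>2)" and ?I = "Z\<^sub>1 \<inter> Z\<^sub>2"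
    have sets: "insert x Z\<^sub>1 \<union> Z\<^sub>2 = ?J" "insert x Z\<^sub>1 \<inter> Z\<^sub>2 = ?I"
      "Z\<^sub>1 \<union> insert x Z\<^sub>2 = ?J" "Z\<^sub>1 \<inter> insert x Z\<^sub>2 = ?I"
      using 1(3) 2(3) insert.hyps(2) by auto
    have "f ?J + f ?I \<le> f (insert x Z\<^sub>1) + f Z\<^sub>2"
      using submodular_onD[OF insert.prems(1), of "insert x Z\<^sub>1" Z\<^sub>2] 1(3) 2(3)
      unfolding sets by blast
    moreover have "g ?J + g ?I \<le> g Z\<^sub>1 + g (insert x Z\<^sub>2)"
      using submodular_onD[OF insert.prems(2), of Z\<^sub>1 "insert x Z\<^sub>2"] 1(3) 2(3)
      unfolding sets by blast
    moreover have "card (?Y - ?J) + card (?Y - ?I) = Suc (card (X - Z\<^sub>1) + card (X - Z\<^sub>2))"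
    proof -
      have "?Y - ?J = (X - Z\<^sub>1) \<inter> (X - Z\<^sub>2)" "?Y - ?I = insert x ((X - Z\<^sub>1) \<union> (X - Z\<^sub>2))"
        using 1(3) 2(3) insert.hyps(2) by auto
      then show ?thesis
        using insert.hyps card_Un_Int[of "X - Z\<^sub>1" "X - Z\<^sub>2"] by simp
    qed
    ultimately have sum: "(f ?J + g ?J + card (?Y - ?J)) + (f ?I + g ?I + card (?Y - ?I))
        \<le> Suc ((f (insert x A\<^sub>1) + g B\<^sub>1) + (f A\<^sub>2 + g (insert x B\<^sub>2)))"
      using 1(4) 2(4) by linarith
    show ?case
    proof (cases "f ?J + g ?J + card (?Y - ?J) \<le> f (insert x A\<^sub>1) + g B\<^sub>1")
      case True
      moreover have "insert x A\<^sub>1 \<union> B\<^sub>1 = ?Y" "insert x A\<^sub>1 \<inter> B\<^sub>1 = {}" "?J \<subseteq> ?Y"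
        using 1 2 insert.hyps(2) by auto
      ultimately show ?thesis by (intro exI[of _ "insert x A\<^sub>1"] exI[of _ B\<^sub>1] exI[of _ ?J] conjI)
    next
      case False
      then have "f ?I + g ?I + card (?Y - ?I) \<le> f A\<^sub>2 + g (insert x B\<^sub>2)"
        using sum by linarith
      moreover have "A\<^sub>2 \<union> insert x B\<^sub>2 = ?Y" "A\<^sub>2 \<inter> insert x B\<^sub>2 = {}" "?I \<subseteq> ?Y"
        using 1 2 insert.hyps(2) by auto
      ultimately show ?thesis by (intro exI[of _ A\<^sub>2] exI[of _ "insert x B\<^sub>2"] exI[of _ ?I] conjI)
    qed
  qed
  then show thesis using that by blast
qed

text \<open>
  Konig's theorem for the bipartite graph in which \<open>d \<in> D\<close> has the neighbourhood \<open>N d\<close>; the cover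
  consists of \<open>K\<close> and of the neighbours of \<open>D - K\<close>. In the induction on \<open>D\<close>, the side \<open>X\<close> is divided
  between the new vertex and the old ones. The minimum cover size of the old graph is submodular as a
  function of the part of \<open>X\<close> that is kept.
\<close>

lemma konig_matching_cover:
  fixes N :: "'d \<Rightarrow> 'x set"
  assumes "finite D" "finite X"
  obtains M K where "M \<subseteq> X \<times> D" "\<And>x d. (x, d) \<in> M \<Longrightarrow> x \<in> N d" "inj_on fst M" "inj_on snd M"
    "K \<subseteq> D" "card K + card (X \<inter> \<Union>(N ` (D - K))) \<le> card M"
proof -
  have "\<exists>M K. M \<subseteq> X \<times> D \<and> (\<forall>(x, d) \<in> M. x \<in> N d) \<and> inj_on fst M \<and> inj_on snd M \<and>
      K \<subseteq> D \<and> card K + card (X \<inter> \<Union>(N ` (D - K))) \<le> card M"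
    using assms
  proof (induction D arbitrary: X rule: finite_induct)
    case empty
    show ?case by (intro exI[of _ "{}"]) auto
  next
    case (insert d D)
    \<comment> \<open>\<open>f\<close> and \<open>g\<close> are the minimum cover sizes of the star at \<open>d\<close> and of the graph on \<open>D\<close>\<close>
    define f where "f Z = (if Z \<inter> N d = {} then 0 else 1 :: nat)" for Z
    define c where "c Z K = card K + card (Z \<inter> \<Union>(N ` (D - K)))" for Z K
    define g where "g Z = (LEAST n. \<exists>K\<subseteq>D. n = c Z K)" for Z
    have g_le: "g Z \<le> c Z K" if "K \<subseteq> D" for Z K
      unfolding g_def using that by (intro Least_le) blast
    have g_ex: "\<exists>K\<subseteq>D. g Z = c Z K" for Z
      unfolding g_def by (rule LeastI_ex) blast
    have "submodular_on X f"
      unfolding submodular_on_def f_def by auto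
    moreover have "submodular_on X g"
      unfolding submodular_on_def
    proof (intro allI impI)
      fix A B assume AB: "A \<subseteq> X" "B \<subseteq> X"
      obtain K L where K: "K \<subseteq> D" "g A = c A K" and L: "L \<subseteq> D" "g B = c B L"
        using g_ex by meson
      let ?NK = "\<Union>(N ` (D - K))" and ?NL = "\<Union>(N ` (D - L))"
      have fin: "finite A" "finite B" "finite K" "finite L"
        using AB K(1) L(1) insert.prems insert.hyps(1) by (auto intro: finite_subset)
      have 1: "(A \<inter> B) \<inter> \<Union>(N ` (D - K \<inter> L)) = (A \<inter> B) \<inter> (?NK \<union> ?NL)" by auto
      have 2: "card ((A \<union> B) \<inter> \<Union>(N ` (D - (K \<union> L)))) \<le> card ((A \<union> B) \<inter> (?NK \<inter> ?NL))"
        using fin by (intro card_mono) auto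
      have "card ((A \<inter> B) \<inter> (?NK \<union> ?NL)) + card ((A \<union> B) \<inter> (?NK \<inter> ?NL))
          \<le> card (A \<inter> ?NK) + card (B \<inter> ?NL)"
      proof -
        let ?P = "(A \<inter> B) \<inter> (?NK \<union> ?NL)" and ?Q = "(A \<union> B) \<inter> (?NK \<inter> ?NL)"
        have "card ?P + card ?Q = card (?P \<union> ?Q) + card (?P \<inter> ?Q)"
          using fin by (intro card_Un_Int) auto
        also have "\<dots> \<le> card (A \<inter> ?NK \<union> B \<inter> ?NL) + card ((A \<inter> ?NK) \<inter> (B \<inter> ?NL))"
          using fin by (intro add_mono card_mono) auto
        also have "\<dots> = card (A \<inter> ?NK) + card (B \<inter> ?NL)"
          using fin by (intro card_Un_Int[symmetric]) auto
        finally show ?thesis .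
      qed
      moreover have "g (A \<union> B) \<le> c (A \<union> B) (K \<union> L)" "g (A \<inter> B) \<le> c (A \<inter> B) (K \<inter> L)"
        using K L by (auto intro!: g_le)
      moreover have "card (K \<union> L) + card (K \<inter> L) = card K + card L"
        by (rule card_Un_Int[OF fin(3,4), symmetric])
      ultimately show "g (A \<union> B) + g (A \<inter> B) \<le> g A + g B"
        using 2 K(2) L(2) unfolding c_def 1 by linarith
    qed
    ultimately obtain A B Z where ABZ: "A \<union> B = X" "A \<inter> B = {}" "Z \<subseteq> X"
      "f Z + g Z + card (X - Z) \<le> f A + g B"
      using submodular_partition[OF insert.prems] by blast
    have finB: "finite B" using ABZ(1) insert.prems by auto
    obtain M K where M: "M \<subseteq> B \<times> D" "\<forall>(x, d) \<in> M. x \<in> N d" "inj_on fst M" "inj_on snd M"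
      "K \<subseteq> D" "c B K \<le> card M"
      using insert.IH[OF finB] unfolding c_def by blast
    have finM: "finite M"
      using finite_subset[OF M(1)] finB insert.hyps(1) by simp
    have "\<exists>M'. M' \<subseteq> X \<times> insert d D \<and> (\<forall>(x, d) \<in> M'. x \<in> N d) \<and> inj_on fst M' \<and> inj_on snd M' \<and>
        card M' = f A + card M"
    proof (cases "A \<inter> N d = {}")
      case True
      then show ?thesis using M ABZ(1) by (intro exI[of _ M]) (auto simp: f_def)
    next
      case False
      then obtain x where x: "x \<in> A" "x \<in> N d" by blast
      have new: "x \<notin> fst ` M" "d \<notin> snd ` M"
        using M(1) x ABZ(2) insert.hyps(2) by auto
      then have "(x, d) \<notin> M" by force
      then show ?thesis using M ABZ(1) x False finM new
        by (intro exI[of _ "insert (x, d) M"]) (auto simp: f_def)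
    qed
    then obtain M' where M': "M' \<subseteq> X \<times> insert d D" "\<forall>(x, d) \<in> M'. x \<in> N d"
      "inj_on fst M'" "inj_on snd M'" "card M' = f A + card M"
      by blast
    obtain L where L: "L \<subseteq> D" "g Z = c Z L" using g_ex by blast
    have finL: "finite L" using finite_subset[OF L(1) insert.hyps(1)] .
    define K' where "K' = (if Z \<inter> N d = {} then L else insert d L)"
    have "X \<inter> \<Union>(N ` (insert d D - K')) \<subseteq> (Z \<inter> \<Union>(N ` (D - L))) \<union> (X - Z)"
      unfolding K'_def by (auto split: if_splits)
    then have "card (X \<inter> \<Union>(N ` (insert d D - K'))) \<le> card (Z \<inter> \<Union>(N ` (D - L))) + card (X - Z)"
      using insert.prems ABZ(3)
      by (intro order.trans[OF card_mono card_Un_le]) (auto intro: finite_subset)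
    moreover have "card K' \<le> f Z + card L"
      unfolding K'_def f_def using finL by (auto simp: card_insert_if)
    moreover have "g B \<le> card M" using g_le[OF M(5)] M(6) le_trans by blast
    ultimately have "card K' + card (X \<inter> \<Union>(N ` (insert d D - K'))) \<le> card M'"
      using ABZ(4) M'(5) L(2) unfolding c_def by linarith
    moreover have "K' \<subseteq> insert d D" using L(1) by (auto simp: K'_def)
    ultimately show ?case using M' by blast
  qed
  then show thesis using that by blast
qed

section \<open>Trees grown from a vertex by adding leaves\<close>

inductive grown_tree :: "'v set \<Rightarrow> 'v set set \<Rightarrow> bool" where
  single: "grown_tree {v} {}"
| leaf: "grown_tree V E \<Longrightarrow> u \<in> V \<Longrightarrow> t \<notin> V \<Longrightarrow> grown_tree (insert t V) (insert {t, u} E)"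

lemma grown_tree_finite:
  assumes "grown_tree V E"
  shows "finite V" "finite E"
  using assms by (induction rule: grown_tree.induct) auto

lemma grown_tree_edge:
  assumes "grown_tree V E" "e \<in> E"
  shows "\<exists>a c. e = {a, c} \<and> a \<noteq> c \<and> a \<in> V \<and> c \<in> V"
  using assms by (induction rule: grown_tree.induct) blast+

lemma grown_tree_edge_subset: "grown_tree V E \<Longrightarrow> e \<in> E \<Longrightarrow> e \<subseteq> V"
  using grown_tree_edge by fastforce

lemma grown_tree_two_sided:
  assumes "grown_tree V E"
  shows "\<exists>b :: 'v \<Rightarrow> bool. \<forall>x y. {x, y} \<in> E \<longrightarrow> (b x \<noteq> b y \<longleftrightarrow> {x, y} \<in> F)"
  using assms
proof (induction rule: grown_tree.induct)
  case (leaf V E u t)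
  then obtain b :: "'v \<Rightarrow> bool" where b: "\<And>x y. {x, y} \<in> E \<Longrightarrow> (b x \<noteq> b y \<longleftrightarrow> {x, y} \<in> F)" by blast
  define b' where "b' = b(t := (b u \<noteq> ({t, u} \<in> F)))"
  have "b' x \<noteq> b' y \<longleftrightarrow> {x, y} \<in> F" if "{x, y} \<in> insert {t, u} E" for x y
  proof (cases "{x, y} = {t, u}")
    case True
    then show ?thesis using leaf.hyps unfolding doubleton_eq_iff b'_def
      by (auto simp: insert_commute)
  next
    case False
    then have "{x, y} \<in> E" using that by simp
    moreover from this have "x \<noteq> t" "y \<noteq> t"
      using grown_tree_edge_subset[OF leaf.hyps(1)] leaf.hyps(3) by blast+
    ultimately show ?thesis using b by (simp add: b'_def)
  qed
  then show ?case by blast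
qed simp

text \<open>
  Connectivity of the subgraph induced on \<open>X\<close>, in a form that survives the deletion of a leaf
  without any talk of paths: a two-colouring that no edge inside \<open>X\<close> notices is constant on \<open>X\<close>.
\<close>

definition linked :: "'v set set \<Rightarrow> 'v set \<Rightarrow> bool" where
  "linked E X \<longleftrightarrow> (\<forall>b :: 'v \<Rightarrow> bool.
     (\<forall>x\<in>X. \<forall>y\<in>X. {x, y} \<in> E \<longrightarrow> b x = b y) \<longrightarrow> (\<forall>x\<in>X. \<forall>y\<in>X. b x = b y))"

lemma linkedD:
  fixes b :: "'v \<Rightarrow> bool"
  assumes "linked E X" "\<And>x y. x \<in> X \<Longrightarrow> y \<in> X \<Longrightarrow> {x, y} \<in> E \<Longrightarrow> b x = b y" "x \<in> X" "y \<in> X"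
  shows "b x = b y"
  using assms(1)[unfolded linked_def, THEN spec, of b] assms(2-4) by blast

text \<open>A colouring of the rest extends to the leaf \<open>t\<close> by the colour of its neighbour.\<close>

lemma linked_remove_leaf:
  assumes "linked (insert {t, u} E) X" "\<And>e. e \<in> E \<Longrightarrow> t \<notin> e"
  shows "linked E (X - {t})"
  unfolding linked_def
proof (intro allI impI ballI)
  fix b :: "'a \<Rightarrow> bool" and x y
  assume b: "\<forall>x\<in>X - {t}. \<forall>y\<in>X - {t}. {x, y} \<in> E \<longrightarrow> b x = b y" and xy: "x \<in> X - {t}" "y \<in> X - {t}"
  have "(b(t := b u)) x = (b(t := b u)) y"
  proof (rule linkedD[OF assms(1)])
    fix x y assume "x \<in> X" "y \<in> X" "{x, y} \<in> insert {t, u} E"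
    then show "(b(t := b u)) x = (b(t := b u)) y"
      using b assms(2)[of "{x, y}"] by (auto simp: doubleton_eq_iff)
  qed (use xy in auto)
  then show "b x = b y" using xy by simp
qed

lemma linked_leaf_only:
  assumes "linked (insert {t, u} E) X" "t \<in> X" "u \<notin> X" "\<And>e. e \<in> E \<Longrightarrow> t \<notin> e"
  shows "X = {t}"
proof -
  have "(y = t) = (t = t)" if "y \<in> X" for y
    by (rule linkedD[OF assms(1), of "\<lambda>z. z = t"])
      (use assms that in \<open>auto simp: doubleton_eq_iff\<close>)
  then have "\<forall>y\<in>X. y = t" by simp
  then show ?thesis using assms(2) by blast
qed

section \<open>Covers\<close>

text \<open>
  The system with supports given by their vertex sets. A loop \<open>{x}\<close> is treated as a pair \<open>{x, y}\<close>
  with \<open>x = y\<close>.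
\<close>

definition hypergraph_system ::
  "'v set set \<Rightarrow> ('x \<Rightarrow> 'v set) \<Rightarrow> ('v set \<Rightarrow> 'x set set) \<Rightarrow> 'x set \<Rightarrow> bool" where
  "hypergraph_system E S A R \<longleftrightarrow>
     (\<forall>x\<in>R. linked E (S x)) \<and>
     (\<forall>a c. {a, c} \<in> E \<longrightarrow>
        (\<forall>x\<in>R. a \<in> S x \<longrightarrow> c \<in> S x \<longrightarrow> {x} \<in> A {a, c}) \<and>
        (\<forall>h\<in>A {a, c}. \<exists>x y. h = {x, y} \<and> a \<in> S x \<and> c \<in> S y))"

lemma hypergraph_systemD:
  assumes "hypergraph_system E S A R"
  shows "x \<in> R \<Longrightarrow> linked E (S x)"
    and "{a, c} \<in> E \<Longrightarrow> x \<in> R \<Longrightarrow> a \<in> S x \<Longrightarrow> c \<in> S x \<Longrightarrow> {x} \<in> A {a, c}"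
    and "{a, c} \<in> E \<Longrightarrow> h \<in> A {a, c} \<Longrightarrow> \<exists>x y. h = {x, y} \<and> a \<in> S x \<and> c \<in> S y"
  using assms unfolding hypergraph_system_def by blast+

lemma hypergraph_system_subset:
  "hypergraph_system E S A R \<Longrightarrow> R' \<subseteq> R \<Longrightarrow> hypergraph_system E S A R'"
  unfolding hypergraph_system_def by blast

definition covers ::
  "'v set set \<Rightarrow> ('v set \<Rightarrow> 'x set set) \<Rightarrow> 'x set \<Rightarrow> 'x set \<Rightarrow> 'v set set \<Rightarrow> bool" where
  "covers E A R W Z \<longleftrightarrow> (\<forall>e\<in>E - Z. \<forall>h\<in>A e. h \<subseteq> R \<longrightarrow> h \<inter> W \<noteq> {})"

lemma coversD: "covers E A R W Z \<Longrightarrow> e \<in> E \<Longrightarrow> e \<notin> Z \<Longrightarrow> h \<in> A e \<Longrightarrow> h \<subseteq> R \<Longrightarrow> h \<inter> W \<noteq> {}"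
  unfolding covers_def by blast

definition cover_cost ::
  "('v set \<Rightarrow> nat) \<Rightarrow> 'v set set \<Rightarrow> ('v set \<Rightarrow> 'x set set) \<Rightarrow> 'x set \<Rightarrow> nat" where
  "cover_cost q E A R =
     (LEAST n. \<exists>W Z. W \<subseteq> R \<and> Z \<subseteq> E \<and> covers E A R W Z \<and> n = card W + sum q Z)"

lemma cover_cost_le:
  "W \<subseteq> R \<Longrightarrow> Z \<subseteq> E \<Longrightarrow> covers E A R W Z \<Longrightarrow> cover_cost q E A R \<le> card W + sum q Z"
  unfolding cover_cost_def by (intro Least_le) blast

lemma cover_cost_attained:
  obtains W Z where "W \<subseteq> R" "Z \<subseteq> E" "covers E A R W Z" "cover_cost q E A R = card W + sum q Z"
proof -
  have "covers E A R {} E" by (auto simp: covers_def)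
  then have "\<exists>n. \<exists>W Z. W \<subseteq> R \<and> Z \<subseteq> E \<and> covers E A R W Z \<and> n = card W + sum q Z"
    by blast
  from LeastI_ex[OF this] show thesis
    unfolding cover_cost_def[symmetric] using that by blast
qed

text \<open>
  The vertices are divided into two sides, with \<open>u\<close> on the first one, that change exactly across
  the edges outside \<open>Z\<^sub>1 \<union> Z\<^sub>2\<close>. A resource in exactly one cover goes to the new cover that belongs to
  its side, an edge in exactly one of \<open>Z\<^sub>1\<close> and \<open>Z\<^sub>2\<close> to the other one. A hyperedge \<open>{x, y}\<close> at an
  edge \<open>e\<close> outside \<open>Z\<^sub>1 \<union> Z\<^sub>2\<close> stays covered because \<open>x\<close> and \<open>y\<close> are then on different sides. If \<open>e\<close>
  is in exactly one of \<open>Z\<^sub>1\<close> and \<open>Z\<^sub>2\<close>, one new cover contains \<open>e\<close>, and the other one contains the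
  resource of \<open>{x, y}\<close> that the old cover without \<open>e\<close> had.
\<close>

lemma covers_split:
  fixes E :: "'v set set" and S :: "'x \<Rightarrow> 'v set"
  assumes tree: "grown_tree V E" and sys: "hypergraph_system E S A R"
    and cov: "covers E A R W\<^sub>1 Z\<^sub>1" "covers E A R W\<^sub>2 Z\<^sub>2"
    and sub: "W\<^sub>1 \<subseteq> R" "W\<^sub>2 \<subseteq> R"
  obtains W W' Z Z' where "covers E A R W Z" "covers E A R W' Z'"
    "W \<union> W' = W\<^sub>1 \<union> W\<^sub>2" "W \<inter> W' = W\<^sub>1 \<inter> W\<^sub>2" "Z \<union> Z' = Z\<^sub>1 \<union> Z\<^sub>2" "Z \<inter> Z' = Z\<^sub>1 \<inter> Z\<^sub>2"
    "\<And>x. x \<in> W\<^sub>1 \<union> W\<^sub>2 \<Longrightarrow> u \<in> S x \<Longrightarrow> x \<in> W"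
proof -
  obtain b\<^sub>0 :: "'v \<Rightarrow> bool" where b\<^sub>0: "\<And>x y. {x, y} \<in> E \<Longrightarrow> b\<^sub>0 x \<noteq> b\<^sub>0 y \<longleftrightarrow> {x, y} \<in> - (Z\<^sub>1 \<union> Z\<^sub>2)"
    using grown_tree_two_sided[OF tree] by metis
  define b where "b v \<longleftrightarrow> b\<^sub>0 v = b\<^sub>0 u" for v
  have b: "b x \<noteq> b y \<longleftrightarrow> {x, y} \<notin> Z\<^sub>1 \<union> Z\<^sub>2" if "{x, y} \<in> E" for x y
    using b\<^sub>0[OF that] by (auto simp: b_def)
  have bu: "b u" by (simp add: b_def)
  define side where "side X \<longleftrightarrow> (\<exists>v\<in>X. b v)" for X
  define W where "W = W\<^sub>1 \<inter> W\<^sub>2 \<union> {x \<in> W\<^sub>1 \<union> W\<^sub>2. side (S x)}"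
  define W' where "W' = W\<^sub>1 \<inter> W\<^sub>2 \<union> {x \<in> W\<^sub>1 \<union> W\<^sub>2. \<not> side (S x)}"
  define Z where "Z = Z\<^sub>1 \<inter> Z\<^sub>2 \<union> {e \<in> Z\<^sub>1 \<union> Z\<^sub>2. \<not> side e}"
  define Z' where "Z' = Z\<^sub>1 \<inter> Z\<^sub>2 \<union> {e \<in> Z\<^sub>1 \<union> Z\<^sub>2. side e}"
  have side_resource: "side (S x) \<longleftrightarrow> b v" if x: "x \<in> R" "x \<notin> W\<^sub>1 \<inter> W\<^sub>2" and v: "v \<in> S x" for x v
  proof -
    have const: "b c = b d" if "c \<in> S x" "d \<in> S x" "{c, d} \<in> E" for c d
    proof -
      have "{x} \<in> A {c, d}" using hypergraph_systemD(2)[OF sys that(3) x(1) that(1,2)] .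
      then have "{c, d} \<in> Z\<^sub>1 \<or> x \<in> W\<^sub>1" "{c, d} \<in> Z\<^sub>2 \<or> x \<in> W\<^sub>2"
        using coversD[OF cov(1) that(3)] coversD[OF cov(2) that(3)] x(1) by auto
      then show ?thesis using b[OF that(3)] x(2) by auto
    qed
    have "b c = b v" if "c \<in> S x" for c
      by (rule linkedD[OF hypergraph_systemD(1)[OF sys x(1)] const that v])
    then show ?thesis using v unfolding side_def by blast
  qed
  have cover: "h \<inter> W \<noteq> {} \<or> e \<in> Z" "h \<inter> W' \<noteq> {} \<or> e \<in> Z'"
    if e: "e \<in> E" and h: "h \<in> A e" "h \<subseteq> R" for e h
  proof -
    obtain a c where ac: "e = {a, c}" using grown_tree_edge[OF tree e] by blast
    obtain x y where xy: "h = {x, y}" "a \<in> S x" "c \<in> S y"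
      using hypergraph_systemD(3)[OF sys] e h(1) unfolding ac by metis
    have R: "x \<in> R" "y \<in> R" using xy(1) h(2) by auto
    note sx = side_resource[OF R(1) _ xy(2)] and sy = side_resource[OF R(2) _ xy(3)]
    have m: "e \<in> Z\<^sub>1 \<or> x \<in> W\<^sub>1 \<or> y \<in> W\<^sub>1" "e \<in> Z\<^sub>2 \<or> x \<in> W\<^sub>2 \<or> y \<in> W\<^sub>2"
      using coversD[OF cov(1) e _ h] coversD[OF cov(2) e _ h] xy(1) by auto
    have bac: "b a \<noteq> b c \<longleftrightarrow> e \<notin> Z\<^sub>1 \<union> Z\<^sub>2" using b e ac by blast
    have se: "side e \<longleftrightarrow> b a \<or> b c" by (auto simp: side_def ac)
    show "h \<inter> W \<noteq> {} \<or> e \<in> Z" "h \<inter> W' \<noteq> {} \<or> e \<in> Z'"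
      using m bac se sx sy unfolding xy(1) W_def W'_def Z_def Z'_def by blast+
  qed
  show thesis
  proof
    show "covers E A R W Z" "covers E A R W' Z'" using cover unfolding covers_def by auto
  next
    fix x assume "x \<in> W\<^sub>1 \<union> W\<^sub>2" "u \<in> S x"
    then show "x \<in> W" using bu by (auto simp: W_def side_def)
  qed (auto simp: W_def W'_def Z_def Z'_def)
qed

text \<open>
  Complete optimal covers for the shares \<open>B\<close> and \<open>C\<close> to covers of the whole system by the withheld
  resources \<open>X - B\<close> and \<open>X - C\<close>, which are free of charge, and rearrange them. All resources of \<open>X\<close>
  in just one of the covers move into the first new cover, in particular the withheld ones in the
  symmetric difference of \<open>B\<close> and \<open>C\<close>. Hence the first new cover pays only for \<open>B \<inter> C\<close>, and the
  second one, which no longer contains these, serves \<open>B \<union> C\<close> without extra cost.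
\<close>

lemma cover_cost_submodular:
  assumes tree: "grown_tree V E" and sys: "hypergraph_system E S A (R \<union> X)"
    and fin: "finite R" "finite X" and disj: "R \<inter> X = {}" and X: "\<And>x. x \<in> X \<Longrightarrow> u \<in> S x"
  shows "submodular_on X (\<lambda>Y. cover_cost q E A (R \<union> Y))"
  unfolding submodular_on_def
proof (intro allI impI)
  fix B C assume BC: "B \<subseteq> X" "C \<subseteq> X"
  obtain W\<^sub>1 Z\<^sub>1 where 1: "W\<^sub>1 \<subseteq> R \<union> B" "Z\<^sub>1 \<subseteq> E" "covers E A (R \<union> B) W\<^sub>1 Z\<^sub>1"
    "cover_cost q E A (R \<union> B) = card W\<^sub>1 + sum q Z\<^sub>1"
    by (rule cover_cost_attained)
  obtain W\<^sub>2 Z\<^sub>2 where 2: "W\<^sub>2 \<subseteq> R \<union> C" "Z\<^sub>2 \<subseteq> E" "covers E A (R \<union> C) W\<^sub>2 Z\<^sub>2"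
    "cover_cost q E A (R \<union> C) = card W\<^sub>2 + sum q Z\<^sub>2"
    by (rule cover_cost_attained)
  have finite: "finite B" "finite C" "finite W\<^sub>1" "finite W\<^sub>2" "finite Z\<^sub>1" "finite Z\<^sub>2"
    using BC 1 2 fin grown_tree_finite(2)[OF tree] by (auto intro: finite_subset)
  have "covers E A (R \<union> X) (W\<^sub>1 \<union> (X - B)) Z\<^sub>1"
    unfolding covers_def
  proof (intro ballI impI)
    fix e h assume "e \<in> E - Z\<^sub>1" "h \<in> A e" "h \<subseteq> R \<union> X"
    then show "h \<inter> (W\<^sub>1 \<union> (X - B)) \<noteq> {}" using coversD[OF 1(3), of e h] by blast
  qed
  moreover have "covers E A (R \<union> X) (W\<^sub>2 \<union> (X - C)) Z\<^sub>2"
    unfolding covers_def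
  proof (intro ballI impI)
    fix e h assume "e \<in> E - Z\<^sub>2" "h \<in> A e" "h \<subseteq> R \<union> X"
    then show "h \<inter> (W\<^sub>2 \<union> (X - C)) \<noteq> {}" using coversD[OF 2(3), of e h] by blast
  qed
  moreover have "W\<^sub>1 \<union> (X - B) \<subseteq> R \<union> X" "W\<^sub>2 \<union> (X - C) \<subseteq> R \<union> X"
    using 1(1) 2(1) BC by auto
  ultimately obtain W W' Z Z' where cov: "covers E A (R \<union> X) W Z" "covers E A (R \<union> X) W' Z'"
    and W: "W \<union> W' = (W\<^sub>1 \<union> (X - B)) \<union> (W\<^sub>2 \<union> (X - C))"
      "W \<inter> W' = (W\<^sub>1 \<union> (X - B)) \<inter> (W\<^sub>2 \<union> (X - C))"
    and Z: "Z \<union> Z' = Z\<^sub>1 \<union> Z\<^sub>2" "Z \<inter> Z' = Z\<^sub>1 \<inter> Z\<^sub>2"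
    and root: "\<And>x. x \<in> (W\<^sub>1 \<union> (X - B)) \<union> (W\<^sub>2 \<union> (X - C)) \<Longrightarrow> u \<in> S x \<Longrightarrow> x \<in> W"
    by (rule covers_split[OF tree sys]) auto
  have finZ: "finite Z" "finite Z'"
    using Z(1) finite(5,6) by (metis finite_Un)+
  let ?P = "W \<inter> (R \<union> B \<inter> C)" and ?Q = "W' \<inter> (R \<union> (B \<union> C))"
  have "cover_cost q E A (R \<union> B \<inter> C) \<le> card ?P + sum q Z"
  proof (rule cover_cost_le)
    show "covers E A (R \<union> B \<inter> C) ?P Z"
      unfolding covers_def
    proof (intro ballI impI)
      fix e h assume "e \<in> E - Z" "h \<in> A e" "h \<subseteq> R \<union> B \<inter> C"
      then show "h \<inter> ?P \<noteq> {}" using coversD[OF cov(1), of e h] BC by blast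
    qed
  qed (use Z(1) 1(2) 2(2) in auto)
  moreover have "cover_cost q E A (R \<union> (B \<union> C)) \<le> card ?Q + sum q Z'"
  proof (rule cover_cost_le)
    show "covers E A (R \<union> (B \<union> C)) ?Q Z'"
      unfolding covers_def
    proof (intro ballI impI)
      fix e h assume "e \<in> E - Z'" "h \<in> A e" "h \<subseteq> R \<union> (B \<union> C)"
      then show "h \<inter> ?Q \<noteq> {}" using coversD[OF cov(2), of e h] BC by blast
    qed
  qed (use Z(1) 1(2) 2(2) in auto)
  moreover have "sum q Z + sum q Z' = sum q Z\<^sub>1 + sum q Z\<^sub>2"
    using sum.union_inter[OF finZ, of q] sum.union_inter[OF finite(5,6), of q] Z by simp
  moreover have "card ?P + card ?Q \<le> card W\<^sub>1 + card W\<^sub>2"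
  proof -
    have "?P \<union> ?Q \<subseteq> W\<^sub>1 \<union> W\<^sub>2"
    proof
      fix x assume x: "x \<in> ?P \<union> ?Q"
      have "x \<in> W\<^sub>1 \<union> W\<^sub>2" if "x \<notin> R" "x \<in> W'" "x \<in> B \<union> C"
      proof -
        have "u \<in> S x" using that(3) BC X by blast
        then have "x \<in> W" using root W(1) that(2) by blast
        then show ?thesis using W(2) that(2,3) by blast
      qed
      moreover have "x \<in> W\<^sub>1 \<union> W\<^sub>2" if "x \<in> R \<or> x \<in> B \<inter> C" "x \<in> W \<union> W'"
        using that W(1) disj by blast
      ultimately show "x \<in> W\<^sub>1 \<union> W\<^sub>2" using x by blast
    qed
    moreover have "?P \<inter> ?Q \<subseteq> W\<^sub>1 \<inter> W\<^sub>2" using W(2) disj by blast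
    moreover have "finite ?P" "finite ?Q" using fin finite by auto
    ultimately show ?thesis
      using card_Un_Int[of ?P ?Q] card_Un_Int[of W\<^sub>1 W\<^sub>2] finite(3,4)
        card_mono[of "W\<^sub>1 \<union> W\<^sub>2" "?P \<union> ?Q"] card_mono[of "W\<^sub>1 \<inter> W\<^sub>2" "?P \<inter> ?Q"] by simp
  qed
  ultimately show "cover_cost q E A (R \<union> (B \<union> C)) + cover_cost q E A (R \<union> B \<inter> C)
      \<le> cover_cost q E A (R \<union> B) + cover_cost q E A (R \<union> C)"
    using 1(4) 2(4) by linarith
qed

section \<open>Packings as large as the cheapest cover\<close>

definition packing ::
  "('v set \<Rightarrow> nat) \<Rightarrow> 'v set set \<Rightarrow> ('v set \<Rightarrow> 'x set set) \<Rightarrow> 'x set \<Rightarrow> ('v set \<times> 'x set) set \<Rightarrow> bool"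
where
  "packing q E A R P \<longleftrightarrow>
     P \<subseteq> (SIGMA e:E. {h \<in> A e. h \<subseteq> R}) \<and> disjoint_family_on snd P \<and>
     (\<forall>e\<in>E. card {h. (e, h) \<in> P} \<le> q e)"

lemma packing_finite:
  assumes "packing q E A R P" "finite E" "finite R"
  shows "finite P"
proof (rule finite_subset)
  show "P \<subseteq> E \<times> Pow R" using assms(1) unfolding packing_def by auto
qed (use assms(2,3) in simp)

lemma packing_union:
  assumes P: "packing q E A R P" and P': "packing q E' A R' P'"
    and disj: "E \<inter> E' = {}" "R \<inter> R' = {}"
  shows "packing q (E \<union> E') A (R \<union> R') (P \<union> P')"
  unfolding packing_def
proof (intro conjI ballI)
  note D = P[unfolded packing_def] and D' = P'[unfolded packing_def]
  show "P \<union> P' \<subseteq> (SIGMA e:E \<union> E'. {h \<in> A e. h \<subseteq> R \<union> R'})" using D D' by blast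
  have sub: "snd p \<subseteq> R" if "p \<in> P" for p using D that by (cases p) auto
  have sub': "snd p \<subseteq> R'" if "p \<in> P'" for p using D' that by (cases p) auto
  show "disjoint_family_on snd (P \<union> P')"
    unfolding disjoint_family_on_def
  proof (intro ballI impI)
    fix p r assume pr: "p \<in> P \<union> P'" "r \<in> P \<union> P'" "p \<noteq> r"
    consider "p \<in> P" "r \<in> P" | "p \<in> P'" "r \<in> P'" | "p \<in> P" "r \<in> P'" | "p \<in> P'" "r \<in> P"
      using pr by blast
    then show "snd p \<inter> snd r = {}"
    proof cases
      case 1 then show ?thesis using D pr(3) unfolding disjoint_family_on_def by blast
    next
      case 2 then show ?thesis using D' pr(3) unfolding disjoint_family_on_def by blast
    next
      case 3 then show ?thesis using sub[of p] sub'[of r] disj(2) by blast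
    next
      case 4 then show ?thesis using sub[of r] sub'[of p] disj(2) by blast
    qed
  qed
  fix e assume "e \<in> E \<union> E'"
  moreover have "{h. (e, h) \<in> P \<union> P'} = {h. (e, h) \<in> P}" if "e \<in> E"
    using that D' disj(1) by auto
  moreover have "{h. (e, h) \<in> P \<union> P'} = {h. (e, h) \<in> P'}" if "e \<in> E'"
    using that D disj(1) by auto
  ultimately show "card {h. (e, h) \<in> P \<union> P'} \<le> q e" using D D' by auto
qed

text \<open>
  At one edge, all resources whose support contains both ends are used as loops, and the remaining
  ones form a bipartite graph, to which Konig's theorem applies. If this gives more than \<open>q\<close>
  hyperedges, the edge itself is an optimal cover.
\<close>

lemma single_edge_packing:
  fixes S :: "'x \<Rightarrow> 'v set"
  assumes sys: "hypergraph_system {{t, u}} S A R" and fin: "finite R"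
  obtains P where "packing q {{t, u}} A R P" "cover_cost q {{t, u}} A R \<le> card P"
proof -
  let ?e = "{t, u}"
  define C where "C = {x \<in> R. t \<in> S x \<and> u \<in> S x}"
  define L where "L = {x \<in> R. t \<notin> S x \<and> u \<in> S x}"
  define D where "D = {x \<in> R. t \<in> S x \<and> u \<notin> S x}"
  have finite: "finite C" "finite L" "finite D" using fin by (auto simp: C_def L_def D_def)
  define N where "N d = {x. {x, d} \<in> A ?e}" for d
  obtain M K where M: "M \<subseteq> L \<times> D" "\<And>x d. (x, d) \<in> M \<Longrightarrow> x \<in> N d" "inj_on fst M" "inj_on snd M"
    and K: "K \<subseteq> D" "card K + card (L \<inter> \<Union>(N ` (D - K))) \<le> card M"
    using konig_matching_cover[OF finite(3,2), where N = N] by metis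
  have finM: "finite M" using finite_subset[OF M(1)] finite by simp
  have CLD: "C \<inter> L = {}" "C \<inter> D = {}" "L \<inter> D = {}" by (auto simp: C_def L_def D_def)
  define pair where "pair = (\<lambda>(x :: 'x, d). {x, d})"
  define H where "H = (\<lambda>x. {x}) ` C \<union> pair ` M"
  have MLD: "x \<in> L" "d \<in> D" if "(x, d) \<in> M" for x d using M(1) that by auto
  have pair_Int: "p = r" if "p \<in> M" "r \<in> M" "pair p \<inter> pair r \<noteq> {}" for p r
  proof -
    obtain x d y c where p: "p = (x, d)" "r = (y, c)" by fastforce
    then have "x \<in> L" "d \<in> D" "y \<in> L" "c \<in> D" using MLD that by auto
    then have "fst p = fst r \<or> snd p = snd r" using that(3) CLD(3) unfolding p pair_def by auto
    then show ?thesis using M(3,4) that(1,2) by (auto dest: inj_onD)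
  qed
  have pair_ne: "pair p \<noteq> {}" for p by (auto simp: pair_def split: prod.split)
  have pair_sub: "pair p \<subseteq> L \<union> D" if "p \<in> M" for p using MLD that by (auto simp: pair_def)
  have "inj_on pair M"
    by (rule inj_onI) (metis pair_Int pair_ne inf.idem)
  then have "card (pair ` M) = card M" by (rule card_image)
  moreover have "card ((\<lambda>x. {x}) ` C) = card C" by (intro card_image) auto
  moreover have "(\<lambda>x. {x}) ` C \<inter> pair ` M = {}"
    using pair_sub CLD by fastforce
  ultimately have cardH: "card H = card C + card M"
    unfolding H_def using finite finM by (subst card_Un_disjoint) auto
  have H_disj: "h \<inter> h' = {}" if h: "h \<in> H" "h' \<in> H" "h \<noteq> h'" for h h'
  proof -
    consider x y where "h = {x}" "h' = {y}" "x \<in> C" "y \<in> C"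
      | x p where "h = {x}" "h' = pair p" "x \<in> C" "p \<in> M"
      | x p where "h' = {x}" "h = pair p" "x \<in> C" "p \<in> M"
      | p r where "h = pair p" "h' = pair r" "p \<in> M" "r \<in> M"
      using h(1,2) unfolding H_def by blast
    then show ?thesis
    proof cases
      case 1 then show ?thesis using h(3) by blast
    next
      case 2 then show ?thesis using pair_sub[of p] CLD by blast
    next
      case 3 then show ?thesis using pair_sub[of p] CLD by blast
    next
      case 4 then show ?thesis using pair_Int[of p r] h(3) by blast
    qed
  qed
  have H_sub: "H \<subseteq> {h \<in> A ?e. h \<subseteq> R}"
  proof
    fix h assume "h \<in> H"
    then consider x where "x \<in> C" "h = {x}" | x d where "(x, d) \<in> M" "h = {x, d}"
      unfolding H_def pair_def by auto
    then show "h \<in> {h \<in> A ?e. h \<subseteq> R}"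
    proof cases
      case 1
      then show ?thesis using hypergraph_systemD(2)[OF sys, of t u x] by (simp add: C_def)
    next
      case 2
      then show ?thesis using MLD M(2) by (auto simp: N_def L_def D_def)
    qed
  qed
  have pack: "packing q {?e} A R ({?e} \<times> H')" if "H' \<subseteq> H" "card H' \<le> q ?e" for H'
    unfolding packing_def disjoint_family_on_def
  proof (intro conjI ballI impI)
    show "{?e} \<times> H' \<subseteq> (SIGMA e:{?e}. {h \<in> A e. h \<subseteq> R})" using that(1) H_sub by blast
  next
    fix p r assume "p \<in> {?e} \<times> H'" "r \<in> {?e} \<times> H'" "p \<noteq> r"
    then have "snd p \<in> H" "snd r \<in> H" "snd p \<noteq> snd r" using that(1) by auto
    then show "snd p \<inter> snd r = {}" by (rule H_disj)
  qed (use that(2) in simp)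
  show thesis
  proof (cases "card H \<le> q ?e")
    case True
    let ?W = "C \<union> K \<union> (L \<inter> \<Union>(N ` (D - K)))"
    have "covers {?e} A R ?W {}"
      unfolding covers_def
    proof (intro ballI impI)
      fix e h assume e: "e \<in> {?e} - {}" "h \<in> A e" and hR: "h \<subseteq> R"
      then obtain x y where h: "h = {x, y}" "t \<in> S x" "u \<in> S y"
        using hypergraph_systemD(3)[OF sys, of t u h] by auto
      then have "x \<in> C \<or> x \<in> D" "y \<in> C \<or> y \<in> L" using hR by (auto simp: C_def D_def L_def)
      moreover have "y \<in> N x" using e h(1) by (simp add: N_def insert_commute)
      ultimately show "h \<inter> ?W \<noteq> {}" using h(1) by blast
    qed
    moreover have "?W \<subseteq> R" using K(1) by (auto simp: C_def D_def L_def)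
    ultimately have "cover_cost q {?e} A R \<le> card ?W + sum q {}"
      by (intro cover_cost_le) auto
    also have "\<dots> \<le> card C + (card K + card (L \<inter> \<Union>(N ` (D - K))))"
      using card_Un_le[of "C \<union> K" "L \<inter> \<Union>(N ` (D - K))"] card_Un_le[of C K] by simp
    also have "\<dots> \<le> card H" using K(2) cardH by simp
    also have "\<dots> = card ({?e} \<times> H)" by (simp add: card_cartesian_product)
    finally show thesis using that pack[OF subset_refl True] by blast
  next
    case False
    then obtain H' where H': "H' \<subseteq> H" "card H' = q ?e"
      using obtain_subset_with_card_n[of "q ?e" H] by (metis nat_le_linear)
    have "cover_cost q {?e} A R \<le> card ({} :: 'x set) + sum q {?e}"
      by (intro cover_cost_le) (auto simp: covers_def)
    then have "cover_cost q {?e} A R \<le> card ({?e} \<times> H')"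
      using H'(2) by (simp add: card_cartesian_product)
    then show thesis using that pack[OF H'(1)] H'(2) by simp
  qed
qed

text \<open>
  The leaf \<open>t\<close> with neighbour \<open>u\<close> splits the resources into those of \<open>X\<close>, whose support contains
  \<open>u\<close>, those of \<open>D\<close>, whose support is \<open>{t}\<close>, and those of \<open>I\<close>, which are of no use at the edge
  \<open>{t, u}\<close>. Only \<open>X\<close> has to be divided between this edge and the rest of the tree.
\<close>

lemma tree_packing:
  fixes E :: "'v set set" and S :: "'x \<Rightarrow> 'v set"
  assumes "grown_tree V E" "hypergraph_system E S A R" "finite R"
  shows "\<exists>P. packing q E A R P \<and> cover_cost q E A R \<le> card P"
  using assms
proof (induction arbitrary: S R rule: grown_tree.induct)
  case (single v)
  have "cover_cost q {} A R \<le> card ({} :: 'x set) + sum q {}"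
    by (intro cover_cost_le) (auto simp: covers_def)
  then show ?case
    by (intro exI[of _ "{}"]) (simp add: packing_def disjoint_family_on_def)
next
  case (leaf V E u t)
  let ?e = "{t, u}"
  have tE: "t \<notin> e" if "e \<in> E" for e
    using grown_tree_edge_subset[OF leaf.hyps(1) that] leaf.hyps(3) by blast
  have tu: "t \<noteq> u" using leaf.hyps by blast
  have eE: "?e \<notin> E" using tE by blast
  note sys = hypergraph_systemD[OF leaf.prems(1)]
  define X where "X = {x \<in> R. u \<in> S x}"
  define D where "D = {x \<in> R. u \<notin> S x \<and> t \<in> S x}"
  define I where "I = {x \<in> R. u \<notin> S x \<and> t \<notin> S x}"
  have fin: "finite X" "finite D" "finite I" using leaf.prems(2) by (auto simp: X_def D_def I_def)
  have RXDI: "R = D \<union> X \<union> I" "D \<inter> X = {}" "I \<inter> X = {}" "D \<inter> I = {}"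
    by (auto simp: X_def D_def I_def)
  have D_leaf: "S x = {t}" if "x \<in> D" for x
    by (rule linked_leaf_only[OF sys(1)]) (use that tE in \<open>auto simp: D_def\<close>)
  have sys_e: "hypergraph_system {?e} (\<lambda>x. S x \<inter> ?e) A R"
    unfolding hypergraph_system_def
  proof (intro conjI ballI allI impI)
    fix x assume "x \<in> R"
    show "linked {?e} (S x \<inter> ?e)"
      unfolding linked_def
    proof (intro allI impI ballI)
      fix b :: "'v \<Rightarrow> bool" and y z
      assume "\<forall>y\<in>S x \<inter> ?e. \<forall>z\<in>S x \<inter> ?e. {y, z} \<in> {?e} \<longrightarrow> b y = b z"
        "y \<in> S x \<inter> ?e" "z \<in> S x \<inter> ?e"
      then show "b y = b z" by (cases "y = z") auto
    qed
  next
    fix a c x assume "{a, c} \<in> {?e}" "x \<in> R" "a \<in> S x \<inter> ?e" "c \<in> S x \<inter> ?e"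
    then show "{x} \<in> A {a, c}" using sys(2)[of a c x] by auto
  next
    fix a c h assume ac: "{a, c} \<in> {?e}" "h \<in> A {a, c}"
    then obtain x y where "h = {x, y}" "a \<in> S x" "c \<in> S y" using sys(3)[of a c h] by auto
    moreover have "a \<in> ?e" "c \<in> ?e" using ac(1) by auto
    ultimately show "\<exists>x y. h = {x, y} \<and> a \<in> S x \<inter> ?e \<and> c \<in> S y \<inter> ?e" by auto
  qed
  have sys_E: "hypergraph_system E (\<lambda>x. S x - {t}) A R"
    unfolding hypergraph_system_def
  proof (intro conjI ballI allI impI)
    fix x assume "x \<in> R"
    then show "linked E (S x - {t})" using linked_remove_leaf sys(1) tE by metis
  next
    fix a c x assume "{a, c} \<in> E" "x \<in> R" "a \<in> S x - {t}" "c \<in> S x - {t}"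
    then show "{x} \<in> A {a, c}" using sys(2)[of a c x] by auto
  next
    fix a c h assume ac: "{a, c} \<in> E" "h \<in> A {a, c}"
    then obtain x y where "h = {x, y}" "a \<in> S x" "c \<in> S y" using sys(3)[of a c h] by auto
    moreover have "a \<noteq> t" "c \<noteq> t" using tE[OF ac(1)] by auto
    ultimately show "\<exists>x y. h = {x, y} \<and> a \<in> S x - {t} \<and> c \<in> S y - {t}" by auto
  qed
  let ?f = "\<lambda>Y. cover_cost q {?e} A (D \<union> Y)" and ?g = "\<lambda>Y. cover_cost q E A (I \<union> Y)"
  have "grown_tree {t, u} {?e}"
    using grown_tree.leaf[OF grown_tree.single[of u], of u t] tu by simp
  moreover have "hypergraph_system {?e} (\<lambda>x. S x \<inter> ?e) A (D \<union> X)"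
    by (rule hypergraph_system_subset[OF sys_e]) (auto simp: RXDI(1))
  ultimately have "submodular_on X ?f"
    by (rule cover_cost_submodular[where u = u]) (use fin RXDI(2) in \<open>auto simp: X_def\<close>)
  moreover have "hypergraph_system E (\<lambda>x. S x - {t}) A (I \<union> X)"
    by (rule hypergraph_system_subset[OF sys_E]) (auto simp: RXDI(1))
  then have "submodular_on X ?g"
    by (rule cover_cost_submodular[OF leaf.hyps(1), where u = u])
      (use fin RXDI(3) tu in \<open>auto simp: X_def\<close>)
  ultimately obtain B C Z where BCZ: "B \<union> C = X" "B \<inter> C = {}" "Z \<subseteq> X"
    "?f Z + ?g Z + card (X - Z) \<le> ?f B + ?g C"
    by (rule submodular_partition[OF fin(1)])
  have finBC: "finite (D \<union> B)" "finite (I \<union> C)" using BCZ(1) fin by auto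
  have "hypergraph_system {?e} (\<lambda>x. S x \<inter> ?e) A (D \<union> B)"
    by (rule hypergraph_system_subset[OF sys_e]) (use BCZ(1) in \<open>auto simp: RXDI(1)\<close>)
  then obtain P where P: "packing q {?e} A (D \<union> B) P" "?f B \<le> card P"
    by (rule single_edge_packing[OF _ finBC(1)])
  have "hypergraph_system E (\<lambda>x. S x - {t}) A (I \<union> C)"
    by (rule hypergraph_system_subset[OF sys_E]) (use BCZ(1) in \<open>auto simp: RXDI(1)\<close>)
  then obtain P' where P': "packing q E A (I \<union> C) P'" "?g C \<le> card P'"
    using leaf.IH[OF _ finBC(2)] by blast
  have "packing q ({?e} \<union> E) A ((D \<union> B) \<union> (I \<union> C)) (P \<union> P')"
    by (rule packing_union[OF P(1) P'(1)]) (use eE RXDI BCZ(1,2) in auto)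
  moreover have "(D \<union> B) \<union> (I \<union> C) = R" using RXDI(1) BCZ(1) by auto
  ultimately have pack: "packing q (insert ?e E) A R (P \<union> P')" by simp
  have "P \<inter> P' = {}" using P(1) P'(1) eE unfolding packing_def by auto
  moreover have "finite P" "finite P'"
    using packing_finite[OF P(1)] packing_finite[OF P'(1)] finBC grown_tree_finite(2)[OF leaf.hyps(1)]
    by auto
  ultimately have card: "card (P \<union> P') = card P + card P'" by (rule card_Un_disjoint[rotated 2])
  obtain W\<^sub>f Z\<^sub>f where f: "W\<^sub>f \<subseteq> D \<union> Z" "Z\<^sub>f \<subseteq> {?e}" "covers {?e} A (D \<union> Z) W\<^sub>f Z\<^sub>f"
    "?f Z = card W\<^sub>f + sum q Z\<^sub>f" by (rule cover_cost_attained)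
  obtain W\<^sub>g Z\<^sub>g where g: "W\<^sub>g \<subseteq> I \<union> Z" "Z\<^sub>g \<subseteq> E" "covers E A (I \<union> Z) W\<^sub>g Z\<^sub>g"
    "?g Z = card W\<^sub>g + sum q Z\<^sub>g" by (rule cover_cost_attained)
  \<comment> \<open>the set \<open>Z\<close> of the partition lemma gives a cover: with \<open>X - Z\<close> bought, each part only has to deal with its
    share \<open>Z\<close> of \<open>X\<close>\<close>
  let ?W = "W\<^sub>f \<union> W\<^sub>g \<union> (X - Z)"
  have "covers (insert ?e E) A R ?W (Z\<^sub>f \<union> Z\<^sub>g)"
    unfolding covers_def
  proof (intro ballI impI)
    fix e h assume e: "e \<in> insert ?e E - (Z\<^sub>f \<union> Z\<^sub>g)" and h: "h \<in> A e" "h \<subseteq> R"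
    show "h \<inter> ?W \<noteq> {}"
    proof (cases "h \<inter> (X - Z) = {}")
      case True
      show ?thesis
      proof (cases "e = ?e")
        case True
        then obtain x y where xy: "h = {x, y}" "t \<in> S x" "u \<in> S y" using sys(3)[of t u h] h by auto
        then have "h \<subseteq> D \<union> X" using h(2) by (auto simp: D_def X_def)
        then have "h \<subseteq> D \<union> Z" using \<open>h \<inter> (X - Z) = {}\<close> by blast
        then show ?thesis using coversD[OF f(3), of e h] e h True by auto
      next
        case False
        then have eE: "e \<in> E" using e by blast
        obtain a c where ac: "e = {a, c}" using grown_tree_edge[OF leaf.hyps(1) eE] by blast
        then obtain x y where xy: "h = {x, y}" "a \<in> S x" "c \<in> S y" using sys(3)[of a c h] h e by auto
        have "a \<noteq> t" "c \<noteq> t" using tE[OF eE] ac by auto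
        then have "h \<inter> D = {}" using D_leaf xy by auto
        then have "h \<subseteq> I \<union> Z" using True h(2) RXDI(1) by blast
        then show ?thesis using coversD[OF g(3) eE, of h] e h by auto
      qed
    qed blast
  qed
  moreover have "?W \<subseteq> R" using f(1) g(1) BCZ(3) RXDI(1) by blast
  moreover have "Z\<^sub>f \<union> Z\<^sub>g \<subseteq> insert ?e E" using f(2) g(2) by blast
  ultimately have "cover_cost q (insert ?e E) A R \<le> card ?W + sum q (Z\<^sub>f \<union> Z\<^sub>g)"
    by (intro cover_cost_le)
  moreover have "sum q (Z\<^sub>f \<union> Z\<^sub>g) = sum q Z\<^sub>f + sum q Z\<^sub>g"
    using f(2) g(2) eE grown_tree_finite(2)[OF leaf.hyps(1)]
    by (intro sum.union_disjoint) (auto intro: finite_subset)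
  moreover have "card ?W \<le> card W\<^sub>f + card W\<^sub>g + card (X - Z)"
    using card_Un_le[of "W\<^sub>f \<union> W\<^sub>g" "X - Z"] card_Un_le[of W\<^sub>f W\<^sub>g] by linarith
  ultimately have "cover_cost q (insert ?e E) A R \<le> card (P \<union> P')"
    using BCZ(4) P(2) P'(2) f(4) g(4) card by linarith
  then show ?case using pack by blast
qed

section \<open>Finite trees and their subtrees\<close>

lemma pawalk_verts_snoc: "pcas a p u \<Longrightarrow> pawalk_verts a (p @ [(u, t)]) = pawalk_verts a p @ [t]"
  by (induction p arbitrary: a) auto

lemma pcas_snoc: "pcas a p u \<Longrightarrow> pcas a (p @ [(u, t)]) t"
  by (induction p arbitrary: a) auto

lemma grown_tree_path:
  assumes "grown_tree V E" "a \<in> V" "c \<in> V"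
  shows "\<exists>p. pcas a p c \<and> set p \<subseteq> {(x, y). {x, y} \<in> E} \<and>
    distinct (pawalk_verts a p) \<and> set (pawalk_verts a p) \<subseteq> V"
  using assms
proof (induction arbitrary: a c rule: grown_tree.induct)
  case (single v)
  then show ?case by (intro exI[of _ "[]"]) simp
next
  case (leaf V E u t)
  consider "a \<in> V" "c \<in> V" | "a = t" "c = t" | "a = t" "c \<in> V" | "a \<in> V" "c = t"
    using leaf.prems by blast
  then show ?case
  proof cases
    case 1
    then obtain p where "pcas a p c" "set p \<subseteq> {(x, y). {x, y} \<in> E}" "distinct (pawalk_verts a p)"
      "set (pawalk_verts a p) \<subseteq> V"
      using leaf.IH by blast
    then show ?thesis by (intro exI[of _ p]) auto
  next
    case 2
    then show ?thesis by (intro exI[of _ "[]"]) simp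
  next
    case 3
    then obtain p where "pcas u p c" "set p \<subseteq> {(x, y). {x, y} \<in> E}" "distinct (pawalk_verts u p)"
      "set (pawalk_verts u p) \<subseteq> V"
      using leaf.IH leaf.hyps(2) by blast
    then show ?thesis using 3 leaf.hyps(3) by (intro exI[of _ "(t, u) # p"]) auto
  next
    case 4
    then obtain p where p: "pcas a p u" "set p \<subseteq> {(x, y). {x, y} \<in> E}" "distinct (pawalk_verts a p)"
      "set (pawalk_verts a p) \<subseteq> V"
      using leaf.IH leaf.hyps(2) by blast
    then show ?thesis using 4 leaf.hyps(3) pcas_snoc[OF p(1)] pawalk_verts_snoc[OF p(1)]
      by (intro exI[of _ "p @ [(u, t)]"]) (auto simp: insert_commute)
  qed
qed

lemma uedges_iff:
  assumes "pair_graph T"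
  shows "{a, c} \<in> uedges T \<longleftrightarrow> (a, c) \<in> parcs T"
proof -
  interpret pair_graph T by fact
  have "(y, x) \<in> parcs T" if "(x, y) \<in> parcs T" for x y
    using that pair_sym_arcs unfolding symmetric_def by (auto dest: symD)
  then show ?thesis unfolding uedges_def by (auto simp: doubleton_eq_iff)
qed

lemma connected_const:
  fixes b :: "'v \<Rightarrow> bool"
  assumes "connected (with_proj T)" "\<And>x y. (x, y) \<in> parcs T \<Longrightarrow> b x = b y"
    and "x \<in> pverts T" "y \<in> pverts T"
  shows "b x = b y"
proof -
  have "x \<rightarrow>\<^sup>*\<^bsub>with_proj (mk_symmetric (with_proj T))\<^esub> y"
    using assms(1,3,4) unfolding connected_def strongly_connected_def by (simp add: mk_symmetric_def)
  then have "(x, y) \<in> (parcs (mk_symmetric (with_proj T)))\<^sup>*"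
    using reachable_rtranclI by (metis with_proj_simps(3))
  then show ?thesis
  proof (induction rule: rtrancl_induct)
    case (step y z)
    then have "(y, z) \<in> parcs T \<or> (z, y) \<in> parcs T" by (auto simp: mk_symmetric_def)
    then show ?case using assms(2)[of y z] assms(2)[of z y] step.IH by blast
  qed simp
qed

lemma connected_linked:
  assumes "connected (with_proj H)" "pair_graph H" "\<And>x y. (x, y) \<in> parcs H \<Longrightarrow> {x, y} \<in> E"
  shows "linked E (pverts H)"
  unfolding linked_def
proof (intro allI impI ballI)
  interpret pair_graph H by fact
  fix b :: "'a \<Rightarrow> bool" and x y
  assume b: "\<forall>x\<in>pverts H. \<forall>y\<in>pverts H. {x, y} \<in> E \<longrightarrow> b x = b y" and xy: "x \<in> pverts H" "y \<in> pverts H"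
  show "b x = b y"
  proof (rule connected_const[OF assms(1) _ xy])
    fix x y assume "(x, y) \<in> parcs H"
    then show "b x = b y" using b assms(3) wellformed' by blast
  qed
qed

text \<open>
  A grown tree inside \<open>T\<close> with as many vertices as possible spans \<open>T\<close>, since \<open>T\<close> is connected.
  An edge of \<open>T\<close> outside of it would close a cycle with the path between its ends.
\<close>

lemma finite_tree_grown:
  assumes "finite_tree T"
  shows "grown_tree (pverts T) (uedges T)"
proof -
  have T: "pair_graph T" "connected (with_proj T)"
    and acyclic: "\<And>p. pre_digraph.cycle (with_proj T) p \<Longrightarrow> \<not> 3 \<le> length p"
    using assms unfolding finite_tree_def by blast+
  interpret pair_graph T by fact
  define P where "P G \<longleftrightarrow> grown_tree (fst G) (snd G) \<and> fst G \<subseteq> pverts T \<and> snd G \<subseteq> uedges T" for G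
  obtain v where v: "v \<in> pverts T"
    using T(2) unfolding connected_def strongly_connected_def by (auto simp: mk_symmetric_def)
  then have "P ({v}, {})" by (simp add: P_def grown_tree.single)
  moreover have "\<forall>G. P G \<longrightarrow> (card \<circ> fst) G < Suc (card (pverts T))"
    unfolding P_def by (auto simp: less_Suc_eq_le intro: card_mono[OF pair_finite_verts])
  ultimately have "\<exists>G. P G \<and> (\<forall>G'. P G' \<longrightarrow> (card \<circ> fst) G' \<le> (card \<circ> fst) G)"
    by (rule ex_has_greatest_nat)
  then obtain G where G: "P G" "\<And>G'. P G' \<Longrightarrow> card (fst G') \<le> card (fst G)"
    unfolding o_def by blast
  define V E where "V = fst G" and "E = snd G"
  have VE: "grown_tree V E" "V \<subseteq> pverts T" "E \<subseteq> uedges T"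
    using G(1) by (auto simp: P_def V_def E_def)
  have max: "card V' \<le> card V" if "grown_tree V' E'" "V' \<subseteq> pverts T" "E' \<subseteq> uedges T" for V' E'
    using G(2)[of "(V', E')"] that by (simp add: P_def V_def)
  have edge: "(x \<in> V) = (y \<in> V)" if "(x, y) \<in> parcs T" for x y
  proof -
    have False if "u \<in> V" "t \<notin> V" "(t, u) \<in> parcs T" for t u
    proof -
      have "grown_tree (insert t V) (insert {t, u} E)"
        using VE(1) that(1,2) by (rule grown_tree.leaf)
      moreover have "insert t V \<subseteq> pverts T" "insert {t, u} E \<subseteq> uedges T"
        using VE(2,3) that(3) wellformed'(1) uedges_iff[OF T(1)] by auto
      ultimately have "card (insert t V) \<le> card V" by (rule max)
      then show False using that(2) grown_tree_finite(1)[OF VE(1)] by simp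
    qed
    moreover have "(y, x) \<in> parcs T"
      using that uedges_iff[OF T(1), of x y] uedges_iff[OF T(1), of y x] by (simp add: insert_commute)
    ultimately show ?thesis using that by blast
  qed
  have "(x \<in> V) = (y \<in> V)" if "x \<in> pverts T" "y \<in> pverts T" for x y
    using T(2) edge that by (rule connected_const)
  moreover obtain w where "w \<in> V" using VE(1) by (cases rule: grown_tree.cases) auto
  ultimately have V: "V = pverts T" using VE(2) by blast
  have "uedges T \<subseteq> E"
  proof
    fix e assume e: "e \<in> uedges T"
    then obtain a c where ac: "e = {c, a}" "(c, a) \<in> parcs T" unfolding uedges_def by blast
    then have verts: "a \<in> V" "c \<in> V" "c \<noteq> a" using V wellformed' pair_no_loops[OF ac(2)] by auto
    obtain p where p: "pcas a p c" "set p \<subseteq> {(x, y). {x, y} \<in> E}" "distinct (pawalk_verts a p)"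
      "set (pawalk_verts a p) \<subseteq> V"
      using grown_tree_path[OF VE(1) verts(1,2)] by blast
    have "set p \<subseteq> parcs T" using p(2) VE(3) uedges_iff[OF T(1)] by blast
    then have "cycle ((c, a) # p)"
      unfolding cycle_def awalk_def using ac(2) p(1,3) verts V by (intro exI[of _ c]) auto
    then have "\<not> 3 \<le> length ((c, a) # p)" by (rule acyclic)
    then consider "p = []" | d where "p = [d]" by (cases p; cases "tl p") auto
    then show "e \<in> E"
    proof cases
      case 1
      then show ?thesis using p(1) verts(3) by simp
    next
      case 2
      then have "p = [(a, c)]" using p(1) by (cases d) auto
      then show ?thesis using p(2) ac(1) by (simp add: insert_commute)
    qed
  qed
  then show ?thesis using VE(1,3) V by auto
qed

lemma tree_structured_imp_hypergraph_system:
  assumes T: "pair_graph T" and Q: "\<forall>x\<in>U. subtree (Q x) T"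
    and A: "tree_structured_hypergraph_system T U Q A"
  shows "hypergraph_system (uedges T) (\<lambda>x. pverts (Q x)) A U"
  unfolding hypergraph_system_def
proof (intro conjI ballI allI impI)
  fix x assume "x \<in> U"
  then have "subtree (Q x) T" using Q by blast
  then have "connected (with_proj (Q x))" "pair_graph (Q x)" "parcs (Q x) \<subseteq> parcs T"
    unfolding subtree_def subgraph_def by auto
  then show "linked (uedges T) (pverts (Q x))"
    by (intro connected_linked) (auto simp: uedges_iff[OF T])
next
  fix a c x assume "{a, c} \<in> uedges T" "x \<in> U" "a \<in> pverts (Q x)" "c \<in> pverts (Q x)"
  then show "{x} \<in> A {a, c}"
    using A unfolding tree_structured_hypergraph_system_def uedges_iff[OF T] resources_at_def by auto
next
  fix a c h assume ac: "{a, c} \<in> uedges T" and h: "h \<in> A {a, c}"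
  have *: "\<And>x. {x} \<in> A {a, c} \<longleftrightarrow> x \<in> resources_at U Q a \<inter> resources_at U Q c"
    "\<And>h. h \<in> A {a, c} \<Longrightarrow> \<not> is_singleton h \<Longrightarrow>
      (\<exists>x y. x \<noteq> y \<and> h = {x, y} \<and> x \<in> resources_at U Q a \<and> y \<in> resources_at U Q c)"
    using A ac unfolding tree_structured_hypergraph_system_def uedges_iff[OF T] by blast+
  show "\<exists>x y. h = {x, y} \<and> a \<in> pverts (Q x) \<and> c \<in> pverts (Q y)"
  proof (cases "is_singleton h")
    case True
    then obtain x where "h = {x, x}" unfolding is_singleton_def by auto
    then show ?thesis using *(1)[of x] h unfolding resources_at_def by auto
  next
    case False
    then show ?thesis using *(2)[OF h] unfolding resources_at_def by auto
  qed
qed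

section \<open>Matchings, partial SDRs and the min-max formula\<close>

lemma matching_card_le:
  assumes "finite H" "matching H M"
  shows "card M \<le> matching_number H"
  unfolding matching_number_def
proof (rule Max_ge)
  have "{card M |M. matching H M} \<subseteq> card ` Pow H" by (auto simp: matching_def)
  then show "finite {card M |M. matching H M}" 
    by (rule finite_subset) (simp add: assms(1))
qed (use assms(2) in blast)

lemma matching_number_le_transversal:
  assumes "finite H" "finite W" "\<And>h. h \<in> H \<Longrightarrow> h \<inter> W \<noteq> {}"
  shows "matching_number H \<le> card W"
proof -
  have "card M \<le> card W" if "matching H M" for M
  proof -
    have M: "M \<subseteq> H" "disjoint M" using that by (auto simp: matching_def)
    have "\<forall>h\<in>M. \<exists>x. x \<in> h \<inter> W" using assms(3) M(1) by blast
    from bchoice[OF this] obtain w where w: "\<And>h. h \<in> M \<Longrightarrow> w h \<in> h \<inter> W" by blast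
    have "inj_on w M"
    proof (rule inj_onI)
      fix h h' assume "h \<in> M" "h' \<in> M" "w h = w h'"
      then have "w h \<in> h \<inter> h'" using w[of h] w[of h'] by simp
      then show "h = h'" using M(2) \<open>h \<in> M\<close> \<open>h' \<in> M\<close> by (auto simp: disjoint_def)
    qed
    then show ?thesis using w assms(2) by (intro card_inj_on_le[of w]) auto
  qed
  moreover have "{card M |M. matching H M} \<subseteq> card ` Pow H" by (auto simp: matching_def)
  then have "finite {card M |M. matching H M}" 
    by (rule finite_subset) (simp add: assms(1))
  moreover have "matching H {}" by (simp add: matching_def)
  ultimately show ?thesis
    unfolding matching_number_def by (subst Max_le_iff) blast+
qed

lemma partial_SDR_size_le:
  assumes M: "partial_SDR T A q M" and fin: "finite (uedges T)" "\<And>e. e \<in> uedges T \<Longrightarrow> finite (A e)"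
    and ne: "\<And>e. e \<in> uedges T \<Longrightarrow> {} \<notin> A e" and F: "F \<subseteq> uedges T"
  shows "(\<Sum>e\<in>uedges T. card (M e)) \<le> sum q (uedges T - F) + matching_number (hyperedges_of A F)"
proof -
  have sub: "M e \<subseteq> A e" "card (M e) \<le> q e" if "e \<in> uedges T" for e
    using M that unfolding partial_SDR_def by auto
  have dis: "h \<inter> h' = {}"
    if "e \<in> F" "h \<in> M e" "e' \<in> F" "h' \<in> M e'" "e \<noteq> e' \<or> h \<noteq> h'" for e h e' h'
  proof -
    have "(e, h) \<in> (SIGMA e:uedges T. M e)" "(e', h') \<in> (SIGMA e:uedges T. M e)" "(e, h) \<noteq> (e', h')"
      using that F by auto
    then have "snd (e, h) \<inter> snd (e', h') = {}"
      using M unfolding partial_SDR_def disjoint_family_on_def by blast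
    then show ?thesis by simp
  qed
  have finF: "finite F" using F fin(1) by (rule finite_subset)
  have "card (\<Union>e\<in>F. M e) = (\<Sum>e\<in>F. card (M e))"
  proof (rule card_UN_disjoint[OF finF])
    show "\<forall>e\<in>F. finite (M e)" using F sub(1) fin(2) by (meson finite_subset subsetD)
    show "\<forall>e\<in>F. \<forall>e'\<in>F. e \<noteq> e' \<longrightarrow> M e \<inter> M e' = {}"
    proof (intro ballI impI)
      fix e e' assume e: "e \<in> F" "e' \<in> F" "e \<noteq> e'"
      have "h = {}" if "h \<in> M e" "h \<in> M e'" for h
        using dis[of e h e' h] that e by blast
      moreover have "{} \<notin> M e" using sub(1)[of e] ne[of e] e(1) F by blast
      ultimately show "M e \<inter> M e' = {}" by blast
    qed
  qed
  moreover have "card (\<Union>e\<in>F. M e) \<le> matching_number (hyperedges_of A F)"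
  proof (rule matching_card_le)
    show "finite (hyperedges_of A F)" unfolding hyperedges_of_def using finF fin(2) F by auto
    show "matching (hyperedges_of A F) (\<Union>e\<in>F. M e)"
      unfolding matching_def hyperedges_of_def
    proof
      show "(\<Union>e\<in>F. M e) \<subseteq> \<Union> (A ` F)" using sub(1) F by blast
      show "disjoint (\<Union>e\<in>F. M e)" unfolding disjoint_def using dis by blast
    qed
  qed
  moreover have "(\<Sum>e\<in>uedges T. card (M e)) = (\<Sum>e\<in>uedges T - F. card (M e)) + (\<Sum>e\<in>F. card (M e))"
    by (rule sum.subset_diff[OF F fin(1)])
  moreover have "(\<Sum>e\<in>uedges T - F. card (M e)) \<le> sum q (uedges T - F)"
    using sub(2) by (intro sum_mono) auto
  ultimately show ?thesis by linarith
qed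

lemma partial_SDR_of_packing:
  assumes P: "packing q (uedges T) A U P" and fin: "finite (uedges T)" "finite P"
  shows "partial_SDR T A q (\<lambda>e. {h. (e, h) \<in> P})"
    and "(\<Sum>e\<in>uedges T. card {h. (e, h) \<in> P}) = card P"
proof -
  note D = P[unfolded packing_def]
  have Sig: "(SIGMA e:uedges T. {h. (e, h) \<in> P}) = P" using D by auto
  show "partial_SDR T A q (\<lambda>e. {h. (e, h) \<in> P})"
    unfolding partial_SDR_def Sig using D by auto
  have "finite {h. (e, h) \<in> P}" for e
    by (rule finite_subset[OF _ finite_imageI[OF fin(2), of snd]]) force
  then show "(\<Sum>e\<in>uedges T. card {h. (e, h) \<in> P}) = card P"
    using card_SigmaI[OF fin(1), of "\<lambda>e. {h. (e, h) \<in> P}"] Sig by simp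
qed

theorem corollary4p1:
  fixes T :: "'v pair_pre_digraph" and U :: "'x set" and Q :: "'x \<Rightarrow> 'v pair_pre_digraph"
    and A :: "'v set \<Rightarrow> 'x set set" and q :: "'v set \<Rightarrow> nat"
  assumes "finite_tree T"
    and "finite U"
    and "\<forall>x\<in>U. subtree (Q x) T"
    and "tree_structured_hypergraph_system T U Q A"
    and "\<forall>e\<in>uedges T. 0 < q e"
  shows "max_partial_SDR T A q =
           Min ((\<lambda>F. sum q (uedges T - F) + matching_number (hyperedges_of A F)) ` Pow (uedges T))
       \<and> int (max_partial_SDR T A q) =
           int (sum q (uedges T)) -
           Max ((\<lambda>F. int (sum q F) - int (matching_number (hyperedges_of A F))) ` Pow (uedges T))"
proof -
  let ?E = "uedges T"
  let ?bound = "\<lambda>F. sum q (?E - F) + matching_number (hyperedges_of A F)"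
  let ?deficit = "\<lambda>F. int (sum q F) - int (matching_number (hyperedges_of A F))"
  let ?sizes = "{\<Sum>e\<in>?E. card (M e) | M. partial_SDR T A q M}"
  have tree: "grown_tree (pverts T) ?E" and T: "pair_graph T"
    using assms(1) finite_tree_grown unfolding finite_tree_def by auto
  have sys: "hypergraph_system ?E (\<lambda>x. pverts (Q x)) A U"
    using tree_structured_imp_hypergraph_system[OF T assms(3,4)] .
  have finE: "finite ?E" by (rule grown_tree_finite(2)[OF tree])
  have A_sub: "A e \<subseteq> Pow U" if "e \<in> ?E" for e
    using that assms(4) unfolding tree_structured_hypergraph_system_def uedges_def by blast
  have finA: "finite (A e)" if "e \<in> ?E" for e
    using finite_subset[OF A_sub[OF that]] assms(2) by simp
  have ne: "{} \<notin> A e" if e: "e \<in> ?E" for e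
  proof
    assume "{} \<in> A e"
    moreover obtain a c where "e = {a, c}" using grown_tree_edge[OF tree e] by blast
    ultimately show False using hypergraph_systemD(3)[OF sys, of a c "{}"] e by blast
  qed
  note le = partial_SDR_size_le[OF _ finE finA ne]
  obtain P where P: "packing q ?E A U P" "cover_cost q ?E A U \<le> card P"
    using tree_packing[OF tree sys assms(2)] by blast
  have finP: "finite P" by (rule packing_finite[OF P(1) finE assms(2)])
  obtain W Z where WZ: "W \<subseteq> U" "Z \<subseteq> ?E" "covers ?E A U W Z" "cover_cost q ?E A U = card W + sum q Z"
    by (rule cover_cost_attained)
  have "matching_number (hyperedges_of A (?E - Z)) \<le> card W"
  proof (rule matching_number_le_transversal)
    show "finite (hyperedges_of A (?E - Z))" unfolding hyperedges_of_def using finE finA by auto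
    show "finite W" using WZ(1) assms(2) by (rule finite_subset)
    fix h assume "h \<in> hyperedges_of A (?E - Z)"
    then show "h \<inter> W \<noteq> {}" using WZ(3) A_sub unfolding covers_def hyperedges_of_def by blast
  qed
  moreover have "?E - (?E - Z) = Z" using WZ(2) by blast
  ultimately have bound_le: "?bound (?E - Z) \<le> card P" using P(2) WZ(4) by simp
  have P_size: "card P \<in> ?sizes"
    using partial_SDR_of_packing[OF P(1) finE finP] by (intro CollectI exI conjI) auto
  have card_P: "card P = ?bound (?E - Z)"
    using bound_le le[OF partial_SDR_of_packing(1)[OF P(1) finE finP], of "?E - Z"]
      partial_SDR_of_packing(2)[OF P(1) finE finP] by (simp add: order_antisym)
  have max: "max_partial_SDR T A q = card P"
    unfolding max_partial_SDR_def
  proof (rule Max_eqI)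
    show upper: "s \<le> card P" if s: "s \<in> ?sizes" for s
    proof -
      obtain M where "s = (\<Sum>e\<in>?E. card (M e))" "partial_SDR T A q M" using s by blast
      then show ?thesis using le[where M = M and F = "?E - Z" and q = q] card_P by simp
    qed
    show "finite ?sizes" using upper by (intro finite_subset[of ?sizes "{..card P}"]) auto
  qed (rule P_size)
  have min: "?bound (?E - Z) \<le> ?bound F" if "F \<in> Pow ?E" for F
    using le[OF partial_SDR_of_packing(1)[OF P(1) finE finP], of F] that
      partial_SDR_of_packing(2)[OF P(1) finE finP] card_P by simp
  have "Min (?bound ` Pow ?E) = ?bound (?E - Z)"
    by (rule Min_eqI) (use finE min in auto)
  moreover have "Max (?deficit ` Pow ?E) = int (sum q ?E) - int (?bound (?E - Z))"
  proof -
    have deficit: "?deficit F = int (sum q ?E) - int (?bound F)" if "F \<in> Pow ?E" for F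
      using sum.subset_diff[of F ?E q] that finE by simp
    show ?thesis
    proof (rule Max_eqI)
      show "finite (?deficit ` Pow ?E)" using finE by simp
      show "y \<le> int (sum q ?E) - int (?bound (?E - Z))" if "y \<in> ?deficit ` Pow ?E" for y
      proof -
        obtain F where F: "F \<in> Pow ?E" "y = ?deficit F" using \<open>y \<in> _\<close> by blast
        show ?thesis using min[OF F(1)] unfolding F(2) deficit[OF F(1)] by linarith
      qed
      show "int (sum q ?E) - int (?bound (?E - Z)) \<in> ?deficit ` Pow ?E"
        using deficit[of "?E - Z"] by (intro image_eqI[of _ _ "?E - Z"]) auto
    qed
  qed
  ultimately show ?thesis using max card_P by simp
qed

end
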